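(* Let $X$ be a connected and locally connected, locally compact, second-countable metrisable space, let $Y$ be a locally compact, second-countable metrisable space, and let $f:X\to Y$ be a function whose graph is closed in $X\times Y$, connected and locally connected. Let $D=D(f)$ be the set of all points of discontinuity of $f$. Then for each $x\in D$ there exist a set $U$ that is open in the graph of $f$ (in the graph topology) and a locally connected continuum $E$ such that: (1) $(x,f(x))\in U\subset E\subset f$; (2) $U\cap f|D = U\cap f|\partial\pi(E)$ (so $x\in\partial\pi(E)$); (3) for every net $(x_n)$ in $X\setminus\pi(E)$ with $x_n\to x$, we have $f(x_n)\to\emptyset$; (4) $X\setminus\pi(E)$ has finitely many connected components.
   Context: A function $f:X\to Y$ is identified with its graph $\{(x,f(x)):x\in X\}\subset X\times Y$, equipped with the subspace topology of the product (the graph topology); set-theoretic operations and relations involving $f$ refer to the graph. For $A\subset X$, $f|A$ is the restriction of $f$ to $A$, identified with its graph $\{(x,f(x)):x\in A\}$. $\pi:X\times Y\to X$ is the projection $\pi(x,y)=x$. $\partial$ denotes the topological boundary in $X$. For a net $(y_n)$ in $Y$, the notation $y_n\to\emptyset$ means that $(y_n)$ has no convergent subnet in $Y$. A continuum is a compact connected (metrisable) space. *)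

theory Defs
  imports "HOL-Analysis.Analysis"
begin

definition graph_on :: "('a \<Rightarrow> 'b) \<Rightarrow> 'a set \<Rightarrow> ('a \<times> 'b) set" where
  "graph_on f A = {(x, f x) |x. x \<in> A}"

definition discontinuities :: "('a::t2_space \<Rightarrow> 'b::topological_space) \<Rightarrow> 'a set" where
  "discontinuities f = {x. \<not> isCont f x}"

definition directed_set :: "'i set \<Rightarrow> ('i \<Rightarrow> 'i \<Rightarrow> bool) \<Rightarrow> bool" where
  "directed_set I le \<longleftrightarrow> I \<noteq> {} \<and>
     (\<forall>i\<in>I. le i i) \<and>
     (\<forall>i\<in>I. \<forall>j\<in>I. \<forall>k\<in>I. le i j \<longrightarrow> le j k \<longrightarrow> le i k) \<and>
     (\<forall>i\<in>I. \<forall>j\<in>I. \<exists>k\<in>I. le i k \<and> le j k)"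

definition net_converges ::
    "'i set \<Rightarrow> ('i \<Rightarrow> 'i \<Rightarrow> bool) \<Rightarrow> ('i \<Rightarrow> 'a::topological_space) \<Rightarrow> 'a \<Rightarrow> bool" where
  "net_converges I le s l \<longleftrightarrow>
     (\<forall>V. open V \<and> l \<in> V \<longrightarrow> (\<exists>i\<in>I. \<forall>j\<in>I. le i j \<longrightarrow> s j \<in> V))"

text \<open>Subnets in the sense of Kelley: the net \<open>s \<circ> h\<close> over \<open>(J, leJ)\<close> is a subnet of
  the net \<open>s\<close> over \<open>(I, leI)\<close>.\<close>

definition subnet_map ::
    "'j set \<Rightarrow> ('j \<Rightarrow> 'j \<Rightarrow> bool) \<Rightarrow> 'i set \<Rightarrow> ('i \<Rightarrow> 'i \<Rightarrow> bool) \<Rightarrow> ('j \<Rightarrow> 'i) \<Rightarrow> bool" where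
  "subnet_map J leJ I leI h \<longleftrightarrow>
     directed_set J leJ \<and> h ` J \<subseteq> I \<and>
     (\<forall>i\<in>I. \<exists>j\<in>J. \<forall>j'\<in>J. leJ j j' \<longrightarrow> leI i (h j'))"

text \<open>A definition cannot quantify over the type of the index set of a subnet. The type
  \<open>'i \<times> 'b set\<close> used here is large enough: \<open>net_to_empty_any_subnet\<close> below shows that
  there is then no convergent subnet indexed by a set of any other type either.\<close>

definition net_to_empty ::
    "'i set \<Rightarrow> ('i \<Rightarrow> 'i \<Rightarrow> bool) \<Rightarrow> ('i \<Rightarrow> 'b::topological_space) \<Rightarrow> bool" where
  "net_to_empty I le s \<longleftrightarrow>
     \<not> (\<exists>(J :: ('i \<times> 'b set) set) leJ h l.
          subnet_map J leJ I le h \<and> net_converges J leJ (s \<circ> h) l)"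

lemma convergent_subnet_imp_cluster:
  assumes "directed_set I le" "subnet_map J leJ I le h" "net_converges J leJ (s \<circ> h) l"
    and V: "open V" "l \<in> V" and i: "i \<in> I"
  shows "\<exists>j\<in>I. le i j \<and> s j \<in> V"
proof -
  have dJ: "directed_set J leJ" and hJ: "h ` J \<subseteq> I"
    using assms(2) by (auto simp: subnet_map_def)
  obtain a where a: "a \<in> J" "\<And>j. j \<in> J \<Longrightarrow> leJ a j \<Longrightarrow> le i (h j)"
    using assms(2) i unfolding subnet_map_def by blast
  obtain b where b: "b \<in> J" "\<And>j. j \<in> J \<Longrightarrow> leJ b j \<Longrightarrow> s (h j) \<in> V"
    using assms(3) V unfolding net_converges_def by fastforce
  obtain c where "c \<in> J" "leJ a c" "leJ b c"
    using dJ a(1) b(1) unfolding directed_set_def by blast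
  then show ?thesis using a b hJ by blast
qed

lemma cluster_imp_convergent_subnet:
  fixes s :: "'i \<Rightarrow> 'b::topological_space"
  assumes d: "directed_set I le"
    and c: "\<And>V i. open V \<Longrightarrow> l \<in> V \<Longrightarrow> i \<in> I \<Longrightarrow> \<exists>j\<in>I. le i j \<and> s j \<in> V"
  shows "\<not> net_to_empty I le s"
proof -
  define J where "J = {(i, V). i \<in> I \<and> open V \<and> l \<in> V \<and> s i \<in> V}"
  define leJ where "leJ = (\<lambda>p q. le (fst p) (fst q) \<and> snd q \<subseteq> (snd p :: 'b set))"
  have refl: "\<And>i. i \<in> I \<Longrightarrow> le i i"
    and tr: "\<And>i j k. i \<in> I \<Longrightarrow> j \<in> I \<Longrightarrow> k \<in> I \<Longrightarrow> le i j \<Longrightarrow> le j k \<Longrightarrow> le i k"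
    and ub: "\<And>i j. i \<in> I \<Longrightarrow> j \<in> I \<Longrightarrow> \<exists>k\<in>I. le i k \<and> le j k"
    and ne: "I \<noteq> {}"
    using d unfolding directed_set_def by blast+
  have top: "(i, UNIV) \<in> J" if "i \<in> I" for i
    using that by (simp add: J_def)
  have "directed_set J leJ"
    unfolding directed_set_def
  proof (intro conjI ballI impI)
    show "J \<noteq> {}" using ne top by blast
    show "leJ p p" if "p \<in> J" for p
      using that refl by (auto simp: J_def leJ_def)
    show "leJ p r" if "p \<in> J" "q \<in> J" "r \<in> J" "leJ p q" "leJ q r" for p q r
      using that tr[of "fst p" "fst q" "fst r"] by (auto simp: J_def leJ_def)
    show "\<exists>r\<in>J. leJ p r \<and> leJ q r" if pq: "p \<in> J" "q \<in> J" for p q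
    proof -
      obtain i V j W where e: "p = (i, V)" "q = (j, W)" by fastforce
      then have m: "i \<in> I" "j \<in> I" "open (V \<inter> W)" "l \<in> V \<inter> W"
        using pq by (auto simp: J_def)
      obtain k where k: "k \<in> I" "le i k" "le j k" using ub m by blast
      obtain k' where k': "k' \<in> I" "le k k'" "s k' \<in> V \<inter> W" using c m k by blast
      have "(k', V \<inter> W) \<in> J" using m k' by (simp add: J_def)
      moreover have "le i k'" "le j k'" using tr m k k' by blast+
      ultimately show ?thesis using e by (force simp: leJ_def)
    qed
  qed
  moreover have "fst ` J \<subseteq> I" by (auto simp: J_def)
  moreover have "\<exists>p\<in>J. \<forall>q\<in>J. leJ p q \<longrightarrow> le i (fst q)" if "i \<in> I" for i
    using top[OF that] by (force simp: leJ_def)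
  moreover have "net_converges J leJ (s \<circ> fst) l"
    unfolding net_converges_def
  proof (intro allI impI)
    fix V assume V: "open V \<and> l \<in> V"
    obtain i where "i \<in> I" using ne by blast
    then obtain j where "j \<in> I" "s j \<in> V" using c V by blast
    then have "(j, V) \<in> J" using V by (simp add: J_def)
    moreover have "\<forall>q\<in>J. leJ (j, V) q \<longrightarrow> (s \<circ> fst) q \<in> V"
      by (auto simp: leJ_def J_def)
    ultimately show "\<exists>p\<in>J. \<forall>q\<in>J. leJ p q \<longrightarrow> (s \<circ> fst) q \<in> V" by blast
  qed
  ultimately show ?thesis unfolding net_to_empty_def subnet_map_def by blast
qed

lemma net_to_empty_any_subnet:
  fixes J :: "'j set" and s :: "'i \<Rightarrow> 'b::topological_space"
  assumes "directed_set I le" "net_to_empty I le s" "subnet_map J leJ I le h"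
  shows "\<not> net_converges J leJ (s \<circ> h) l"
proof
  assume "net_converges J leJ (s \<circ> h) l"
  note convergent_subnet_imp_cluster[OF assms(1,3) this]
  then have "\<not> net_to_empty I le s"
    by (rule cluster_imp_convergent_subnet[OF assms(1)])
  with assms(2) show False by contradiction
qed

text \<open>For every net \<open>s\<close> in \<open>S\<close> converging to \<open>x\<close>, the net \<open>f \<circ> s\<close> tends to the empty set.
  Again the index type has to be fixed, and \<open>'a set \<times> 'a\<close> is large enough by
  \<open>nets_to_empty_any_index\<close> below.\<close>

definition nets_to_empty ::
    "('a::topological_space \<Rightarrow> 'b::topological_space) \<Rightarrow> 'a set \<Rightarrow> 'a \<Rightarrow> bool" where
  "nets_to_empty f S x \<longleftrightarrow>
     (\<forall>(I :: ('a set \<times> 'a) set) le s.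
        directed_set I le \<and> s ` I \<subseteq> S \<and> net_converges I le s x \<longrightarrow> net_to_empty I le (f \<circ> s))"

lemma nets_to_empty_any_index:
  fixes I :: "'i set" and f :: "'a::topological_space \<Rightarrow> 'b::topological_space"
  assumes n: "nets_to_empty f S x"
    and d: "directed_set I le" and s: "s ` I \<subseteq> S" and cv: "net_converges I le s x"
  shows "net_to_empty I le (f \<circ> s)"
proof (rule ccontr)
  assume "\<not> net_to_empty I le (f \<circ> s)"
  then obtain l where c: "\<And>V i. open V \<Longrightarrow> l \<in> V \<Longrightarrow> i \<in> I \<Longrightarrow> \<exists>j\<in>I. le i j \<and> f (s j) \<in> V"
    unfolding net_to_empty_def using convergent_subnet_imp_cluster[OF d] by fastforce
  define T where "T = (\<lambda>i. s ` {j \<in> I. le i j})"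
  define K where "K = {(A, a). a \<in> A \<and> A \<subseteq> S \<and> (\<exists>i\<in>I. T i \<subseteq> A)}"
  define leK where "leK = (\<lambda>(p :: 'a set \<times> 'a) (q :: 'a set \<times> 'a). fst q \<subseteq> fst p)"
  have refl: "\<And>i. i \<in> I \<Longrightarrow> le i i"
    and tr: "\<And>i j k. i \<in> I \<Longrightarrow> j \<in> I \<Longrightarrow> k \<in> I \<Longrightarrow> le i j \<Longrightarrow> le j k \<Longrightarrow> le i k"
    and ub: "\<And>i j. i \<in> I \<Longrightarrow> j \<in> I \<Longrightarrow> \<exists>k\<in>I. le i k \<and> le j k"
    and ne: "I \<noteq> {}"
    using d unfolding directed_set_def by blast+
  have TS: "T i \<subseteq> S" and Ti: "i \<in> I \<Longrightarrow> s i \<in> T i" for i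
    using s refl by (auto simp: T_def)
  have Tmono: "T k \<subseteq> T i" if "i \<in> I" "k \<in> I" "le i k" for i k
    unfolding T_def using tr[OF that(1,2) _ that(3)] by blast
  have memK: "(T i, s i) \<in> K" if "i \<in> I" for i
    using that TS Ti by (auto simp: K_def)
  have "directed_set K leK"
    unfolding directed_set_def
  proof (intro conjI ballI impI)
    show "K \<noteq> {}" using ne memK by blast
    show "leK p p" for p by (simp add: leK_def)
    show "leK p r" if "leK p q" "leK q r" for p q r
      using that by (auto simp: leK_def)
    show "\<exists>r\<in>K. leK p r \<and> leK q r" if pq: "p \<in> K" "q \<in> K" for p q
    proof -
      obtain i j where ij: "i \<in> I" "T i \<subseteq> fst p" "j \<in> I" "T j \<subseteq> fst q"
        using pq by (auto simp: K_def)
      obtain k where k: "k \<in> I" "le i k" "le j k" using ub ij by blast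
      then have "T k \<subseteq> fst p" "T k \<subseteq> fst q" using Tmono ij by blast+
      then have "leK p (T k, s k) \<and> leK q (T k, s k)" by (simp add: leK_def)
      then show ?thesis using memK[OF k(1)] by blast
    qed
  qed
  moreover have "snd ` K \<subseteq> S" by (auto simp: K_def)
  moreover have "net_converges K leK snd x"
    unfolding net_converges_def
  proof (intro allI impI)
    fix V assume "open V \<and> x \<in> V"
    then obtain i where i: "i \<in> I" "T i \<subseteq> V"
      using cv unfolding net_converges_def T_def by blast
    then have "\<forall>q\<in>K. leK (T i, s i) q \<longrightarrow> snd q \<in> V"
      by (auto simp: leK_def K_def)
    then show "\<exists>p\<in>K. \<forall>q\<in>K. leK p q \<longrightarrow> snd q \<in> V" using memK[OF i(1)] by blast
  qed
  ultimately have dK: "directed_set K leK" and e: "net_to_empty K leK (f \<circ> snd)"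
    using n[unfolded nets_to_empty_def, rule_format, of K leK snd] by simp_all
  have "\<exists>q\<in>K. leK p q \<and> (f \<circ> snd) q \<in> V" if V: "open V" "l \<in> V" and p: "p \<in> K" for V p
  proof -
    obtain i where i: "i \<in> I" "T i \<subseteq> fst p" "fst p \<subseteq> S" using p by (auto simp: K_def)
    obtain j where j: "j \<in> I" "le i j" "f (s j) \<in> V" using c V i by blast
    then have "s j \<in> fst p" using i by (auto simp: T_def)
    then have "(fst p, s j) \<in> K" using i by (auto simp: K_def)
    moreover have "leK p (fst p, s j) \<and> (f \<circ> snd) (fst p, s j) \<in> V"
      using j by (simp add: leK_def)
    ultimately show ?thesis by blast
  qed
  then have "\<not> net_to_empty K leK (f \<circ> snd)"
    by (rule cluster_imp_convergent_subnet[OF dK])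
  with e show False by contradiction
qed

end

theory Submission
  imports Defs
begin

text \<open>
  Put \<open>\<Gamma>\<close> for the graph, let \<open>E \<subseteq> \<Gamma>\<close> be any compact neighbourhood in \<open>\<Gamma>\<close> of the point
  \<open>(x, f x)\<close>, with \<open>(x, f x) \<in> U \<subseteq> E\<close> for \<open>U\<close> open in \<open>\<Gamma>\<close>, and let \<open>K\<close> be the projection of \<open>E\<close>.
  The projection maps the compact set \<open>E\<close> homeomorphically onto \<open>K\<close>, so the restriction of \<open>f\<close>
  to \<open>K\<close> is continuous and the discontinuities of \<open>f\<close> in \<open>K\<close> lie on the frontier of \<open>K\<close>;
  conversely continuity at a point below \<open>U\<close> would push a whole neighbourhood of that point
  into \<open>K\<close>. This is the relation between discontinuities and the frontier. If a
  net outside \<open>K\<close> tends to \<open>x\<close> and its values cluster at \<open>l\<close>, closedness of \<open>\<Gamma>\<close> forces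
  \<open>l = f x\<close>, so the net meets the projection of \<open>U\<close>, a contradiction. All this holds for every compact
  neighbourhood. What needs a careful choice is that \<open>E\<close> be connected and locally connected and
  that the complement of \<open>K\<close> have only finitely many components.

  A locally connected continuum \<open>E\<^sub>0\<close> that is a neighbourhood of \<open>(x, f x)\<close> comes from
  \<open>locally_connected_continuum_neighbourhood\<close>, a theorem on locally compact, locally connected
  metric spaces proved by the classical method of property S.

  The complement of its projection \<open>K\<^sub>0\<close> may have infinitely many components, but all except
  finitely many of them can be added to \<open>K\<^sub>0\<close>. Take a compact neighbourhood \<open>F\<close> of \<open>E\<^sub>0\<close> in \<open>\<Gamma>\<close>.
  Since \<open>\<Gamma>\<close> is connected, every component of \<open>\<Gamma> - E\<^sub>0\<close> reaches \<open>E\<^sub>0\<close>, so those that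
  leave \<open>F\<close> must cross the compact collar between \<open>E\<^sub>0\<close> and the outside of \<open>F\<close>, and there are only
  finitely many of them (\<open>finite_components_escaping_compact\<close>). Each projects into a single
  component of the complement of \<open>K\<^sub>0\<close>; over all other components the graph stays in \<open>F\<close>.
  Adding to \<open>E\<^sub>0\<close> the graph over these other components gives a compact set \<open>E\<close>, and adding
  components of the complement preserves connectedness and local connectedness
  (\<open>connected_Un_components\<close>, \<open>locally_connected_Un_components\<close>).
\<close>

section \<open>Compactness relative to a subspace\<close>

lemma compact_openin_subcover:
  assumes "compact K" "K \<subseteq> \<Union>\<C>" "\<And>C. C \<in> \<C> \<Longrightarrow> openin (top_of_set S) C" "K \<subseteq> S"
  obtains \<D> where "finite \<D>" "\<D> \<subseteq> \<C>" "K \<subseteq> \<Union>\<D>"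
proof -
  have "compactin (top_of_set S) K"
    using assms by (simp add: compactin_subtopology)
  then show ?thesis
    using that assms unfolding compactin_def by metis
qed

lemma locally_compact_closedin_subset:
  fixes S :: "'a::metric_space set"
  assumes "locally compact S" "closedin (top_of_set S) T"
  shows "locally compact T"
proof (rule locallyI)
  fix w x
  assume w: "openin (top_of_set T) w" "x \<in> w"
  obtain C where C: "closed C" "T = S \<inter> C"
    using assms(2) unfolding closedin_closed by blast
  obtain W where W: "open W" "w = T \<inter> W"
    using w(1) unfolding openin_open by blast
  obtain u v where uv: "openin (top_of_set S) u" "compact v" "x \<in> u" "u \<subseteq> v" "v \<subseteq> S \<inter> W"
    using locallyE[OF assms(1), of "S \<inter> W" x] W w C by (auto simp: openin_open)
  have "openin (top_of_set T) (T \<inter> u)"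
    using uv(1) C by (auto simp: openin_open)
  moreover have "compact (C \<inter> v)"
    using C uv closed_Int_compact by blast
  moreover have "x \<in> T \<inter> u" "T \<inter> u \<subseteq> C \<inter> v" "C \<inter> v \<subseteq> w"
    using uv w W C by auto
  ultimately show "\<exists>U V. openin (top_of_set T) U \<and> compact V \<and> x \<in> U \<and> U \<subseteq> V \<and> V \<subseteq> w"
    by blast
qed

lemma compact_neighbourhood_of_compact:
  assumes lc: "locally compact S" and K: "compact K" "K \<subseteq> S"
  obtains U F where "openin (top_of_set S) U" "compact F" "K \<subseteq> U" "U \<subseteq> F" "F \<subseteq> S"
proof -
  have "\<exists>U F. openin (top_of_set S) U \<and> compact F \<and> x \<in> U \<and> U \<subseteq> F \<and> F \<subseteq> S" if "x \<in> K" for x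
  proof -
    have "x \<in> S" using that K(2) by blast
    then show ?thesis by (rule locallyE[OF lc openin_subtopology_self]) blast
  qed
  then obtain U F where UF: "\<And>x. x \<in> K \<Longrightarrow> openin (top_of_set S) (U x) \<and> compact (F x) \<and>
      x \<in> U x \<and> U x \<subseteq> F x \<and> F x \<subseteq> S"
    by metis
  obtain \<D> where \<D>: "finite \<D>" "\<D> \<subseteq> U ` K" "K \<subseteq> \<Union>\<D>"
    by (rule compact_openin_subcover[OF K(1) _ _ K(2), of "U ` K"]) (use UF in auto)
  then obtain J where J: "finite J" "J \<subseteq> K" "\<D> = U ` J"
    by (meson finite_subset_image)
  show ?thesis
  proof
    show "openin (top_of_set S) (\<Union>(U ` J))" using J UF by blast
    show "compact (\<Union>(F ` J))" using J UF by (intro compact_UN) auto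
    show "K \<subseteq> \<Union>(U ` J)" using \<D> J by simp
    show "\<Union>(U ` J) \<subseteq> \<Union>(F ` J)" "\<Union>(F ` J) \<subseteq> S" using J UF by blast+
  qed
qed

section \<open>Locally connected continua as neighbourhoods\<close>

text \<open>Property S of Sierpinski, here for a decomposition into closed pieces. The pieces that
  avoid a point \<open>x\<close> have closed union, and the pieces through \<open>x\<close> connect \<open>x\<close> to every point
  outside that union.\<close>

lemma property_S_imp_locally_connected:
  fixes E :: "'a::metric_space set"
  assumes S: "\<And>e. e > 0 \<Longrightarrow> \<exists>\<P>. finite \<P> \<and> E = \<Union>\<P> \<and>
      (\<forall>P\<in>\<P>. closed P \<and> connected P \<and> (\<forall>x\<in>P. \<forall>y\<in>P. dist x y \<le> e))"
  shows "locally connected E"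
  unfolding locally_connected_im_kleinen
proof (intro allI impI)
  fix v x
  assume v: "openin (top_of_set E) v \<and> x \<in> v"
  then obtain e where e: "e > 0" "\<And>y. y \<in> E \<Longrightarrow> dist x y < e \<Longrightarrow> y \<in> v" and "v \<subseteq> E"
    unfolding openin_euclidean_subtopology_iff by (metis dist_commute)
  obtain \<P> where \<P>: "finite \<P>" "E = \<Union>\<P>"
    "\<And>P. P \<in> \<P> \<Longrightarrow> closed P \<and> connected P \<and> (\<forall>x\<in>P. \<forall>y\<in>P. dist x y \<le> e/2)"
    using S[of "e/2"] e by auto
  define u where "u = E \<inter> - \<Union>{P \<in> \<P>. x \<notin> P}"
  have "closed (\<Union>{P \<in> \<P>. x \<notin> P})" using \<P> by (intro closed_Union) auto
  then have "openin (top_of_set E) u" unfolding u_def by (intro openin_open_Int) auto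
  moreover have "x \<in> u" using v \<open>v \<subseteq> E\<close> by (auto simp: u_def)
  moreover have c: "\<exists>c. connected c \<and> c \<subseteq> v \<and> x \<in> c \<and> y \<in> c" if y: "y \<in> u" for y
  proof -
    obtain P where P: "P \<in> \<P>" "y \<in> P" "x \<in> P" using y \<P>(2) by (auto simp: u_def)
    have "P \<subseteq> v"
    proof
      fix z assume z: "z \<in> P"
      have "dist x z < e" using \<P>(3)[OF P(1)] P z e(1) by fastforce
      then show "z \<in> v" using e(2) z P \<P>(2) by blast
    qed
    then show ?thesis using P \<P>(3) by blast
  qed
  moreover have "u \<subseteq> v" using c by blast
  ultimately show "\<exists>u. openin (top_of_set E) u \<and> x \<in> u \<and> u \<subseteq> v \<and>
      (\<forall>y. y \<in> u \<longrightarrow> (\<exists>c. connected c \<and> c \<subseteq> v \<and> x \<in> c \<and> y \<in> c))"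
    by blast
qed

definition star :: "'a set set \<Rightarrow> 'a set \<Rightarrow> 'a set" where
  "star \<U> A = A \<union> \<Union>{V \<in> \<U>. V \<inter> A \<noteq> {}}"

text \<open>The \<open>n\<close>-fold star with respect to the families numbered \<open>k, k + 1, \<dots>, k + n - 1\<close>. The
  starting index is a parameter because the tail of one such iteration is again one.\<close>

primrec stars :: "(nat \<Rightarrow> 'a set set) \<Rightarrow> nat \<Rightarrow> nat \<Rightarrow> 'a set \<Rightarrow> 'a set" where
  "stars \<U> k 0 A = A"
| "stars \<U> k (Suc n) A = star (\<U> (k + n)) (stars \<U> k n A)"

lemma stars_add: "stars \<U> 0 (k + n) A = stars \<U> k n (stars \<U> 0 k A)"
  by (induction n) auto

lemma stars_superset: "A \<subseteq> stars \<U> k n A"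
  by (induction n) (auto simp: star_def)

lemma star_Union: "star \<U> (\<Union>\<A>) = (\<Union>A\<in>\<A>. star \<U> A)"
  unfolding star_def by blast

lemma stars_Union: "stars \<U> k n (\<Union>\<A>) = (\<Union>A\<in>\<A>. stars \<U> k n A)"
proof (induction n)
  case (Suc n)
  then show ?case using star_Union[of "\<U> (k + n)" "stars \<U> k n ` \<A>"] by simp
qed simp

lemma connected_star:
  assumes "connected A" "\<And>V. V \<in> \<U> \<Longrightarrow> connected V"
  shows "connected (star \<U> A)"
proof (cases "A = {}")
  case False
  have "connected (\<Union>(insert A ((\<lambda>V. A \<union> V) ` {V \<in> \<U>. V \<inter> A \<noteq> {}})))"
    using assms False by (intro connected_Union) (auto intro!: connected_Un)
  also have "\<Union>(insert A ((\<lambda>V. A \<union> V) ` {V \<in> \<U>. V \<inter> A \<noteq> {}})) = star \<U> A"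
    unfolding star_def by blast
  finally show ?thesis .
qed (simp add: star_def)

lemma connected_stars:
  assumes "connected A" "\<And>i V. V \<in> \<U> i \<Longrightarrow> connected V"
  shows "connected (stars \<U> k n A)"
  by (induction n) (use assms in \<open>auto intro: connected_star\<close>)

lemma connected_UN_stars:
  assumes "connected A" "A \<noteq> {}" "\<And>i V. V \<in> \<U> i \<Longrightarrow> connected V"
  shows "connected (\<Union>n. stars \<U> k n A)"
proof (rule connected_Union)
  show "connected T" if "T \<in> range (\<lambda>n. stars \<U> k n A)" for T
    using that by (auto intro: connected_stars assms)
  have "A \<subseteq> \<Inter>(range (\<lambda>n. stars \<U> k n A))"
    by (simp add: le_INF_iff stars_superset)
  then show "\<Inter>(range (\<lambda>n. stars \<U> k n A)) \<noteq> {}" using assms(2) by blast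
qed

text \<open>The geometric series: the \<open>i\<close>-th family moves a point by at most \<open>r / 2 ^ i\<close>, so the
  iteration that starts at index \<open>k\<close> moves it by at most \<open>2 * r / 2 ^ k\<close> in total.\<close>

lemma stars_dist:
  fixes A :: "'a::metric_space set"
  assumes small: "\<And>i V x y. V \<in> \<U> i \<Longrightarrow> x \<in> V \<Longrightarrow> y \<in> V \<Longrightarrow> dist x y \<le> r / 2^i"
    and r: "r \<ge> 0" and y: "y \<in> stars \<U> k n A"
  shows "\<exists>a\<in>A. dist a y \<le> 2 * r / 2^k"
proof -
  \<comment> \<open>Subtracting the remainder of the series leaves room for the next step of the induction.\<close>
  have "\<exists>a\<in>A. dist a y \<le> 2 * r / 2^k - 2 * r / 2^(k + n)"
    using y
  proof (induction n arbitrary: y)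
    case 0
    then show ?case by auto
  next
    case (Suc n)
    have step: "- 2 * r / 2^(k + n) + r / 2^(k + n) = - 2 * r / 2^(k + Suc n)"
      by (simp add: field_simps)
    have pos: "r / 2^(k + n) \<ge> 0" using r by simp
    consider "y \<in> stars \<U> k n A"
      | V z where "V \<in> \<U> (k + n)" "y \<in> V" "z \<in> V" "z \<in> stars \<U> k n A"
      using Suc.prems by (auto simp: star_def)
    then show ?case
    proof cases
      case 1
      then obtain a where "a \<in> A" "dist a y \<le> 2 * r / 2^k - 2 * r / 2^(k + n)"
        using Suc.IH by blast
      then show ?thesis using step pos by (intro bexI[of _ a]) auto
    next
      case 2
      then obtain a where a: "a \<in> A" "dist a z \<le> 2 * r / 2^k - 2 * r / 2^(k + n)"
        using Suc.IH by blast
      have "dist z y \<le> r / 2^(k + n)" using small 2 by blast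
      then show ?thesis using step a dist_triangle[of a y z] by (intro bexI[of _ a]) auto
    qed
  qed
  then obtain a where "a \<in> A" "dist a y \<le> 2 * r / 2^k - 2 * r / 2^(k + n)" by blast
  moreover have "2 * r / 2^(k + n) \<ge> 0" using r by simp
  ultimately show ?thesis by (intro bexI[of _ a]) linarith+
qed

lemma closure_finite_UN:
  assumes "finite I"
  shows "closure (\<Union>i\<in>I. A i) = (\<Union>i\<in>I. closure (A i))"
  using assms by (induction I) simp_all

text \<open>Start from a point \<open>p\<close> and take stars with respect to finite families of connected open
  sets of size \<open>r / 2 ^ i\<close> that cover a compact neighbourhood of \<open>p\<close>. The union \<open>M\<close> of all
  stages has property S: the stage \<open>k + 1\<close> is a finite union of members \<open>V\<close> of the \<open>k\<close>-th
  family, taking stars commutes with unions, and what grows from one \<open>V\<close> is connected of size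
  comparable to \<open>r / 2 ^ k\<close>. Closing up the pieces gives property S for the closure of \<open>M\<close>.\<close>

lemma locally_connected_continuum_neighbourhood:
  fixes S :: "'a::metric_space set"
  assumes lc: "locally compact S" and lconn: "locally connected S" and p: "p \<in> S"
  obtains U E where "openin (top_of_set S) U" "p \<in> U" "U \<subseteq> E" "E \<subseteq> S"
    "compact E" "connected E" "locally connected E"
proof -
  obtain W F where WF: "openin (top_of_set S) W" "compact F" "p \<in> W" "W \<subseteq> F" "F \<subseteq> S"
    using locallyE[OF lc openin_subtopology_self p] by blast
  then obtain e where e: "e > 0" "\<And>y. y \<in> S \<Longrightarrow> dist p y < e \<Longrightarrow> y \<in> W"
    unfolding openin_euclidean_subtopology_iff by (metis dist_commute)
  \<comment> \<open>All stages stay within distance \<open>2 * r\<close> of \<open>p\<close>, hence inside \<open>W\<close>.\<close>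
  define r where "r = e / 3"
  have r: "r > 0" "2 * r < e" using e by (auto simp: r_def)
  have "\<exists>\<V>. finite \<V> \<and> F \<subseteq> \<Union>\<V> \<and> (\<forall>V\<in>\<V>. openin (top_of_set S) V \<and> connected V \<and>
      (\<forall>x\<in>V. \<forall>y\<in>V. dist x y \<le> r / 2^i))" for i :: nat
  proof -
    define \<C> where "\<C> = {V. openin (top_of_set S) V \<and> connected V \<and>
      (\<forall>x\<in>V. \<forall>y\<in>V. dist x y \<le> r / 2^i)}"
    have "F \<subseteq> \<Union>\<C>"
    proof
      fix x assume x: "x \<in> F"
      define d where "d = r / 2^i / 2"
      have "d > 0" using r by (simp add: d_def)
      then have "openin (top_of_set S) (S \<inter> ball x d)" "x \<in> S \<inter> ball x d"
        using x WF(5) by (auto intro: openin_open_Int)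
      then obtain V where V: "openin (top_of_set S) V" "connected V" "x \<in> V" "V \<subseteq> S \<inter> ball x d"
        using lconn unfolding locally_connected by meson
      have "dist y z \<le> r / 2^i" if "y \<in> V" "z \<in> V" for y z
      proof -
        have "dist x y < d" "dist x z < d" using that V(4) by auto
        then show ?thesis using dist_triangle2[of y z x] by (simp add: d_def dist_commute)
      qed
      then show "x \<in> \<Union>\<C>" using V by (auto simp: \<C>_def)
    qed
    then obtain \<V> where "finite \<V>" "\<V> \<subseteq> \<C>" "F \<subseteq> \<Union>\<V>"
      by (rule compact_openin_subcover[OF WF(2) _ _ WF(5)]) (auto simp: \<C>_def)
    then show ?thesis unfolding \<C>_def by blast
  qed
  then obtain \<U> where fin: "\<And>i::nat. finite (\<U> i)" and cover: "\<And>i. F \<subseteq> \<Union>(\<U> i)"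
    and open\<U>: "\<And>i V. V \<in> \<U> i \<Longrightarrow> openin (top_of_set S) V"
    and conn\<U>: "\<And>i V. V \<in> \<U> i \<Longrightarrow> connected V"
    and small: "\<And>i V x y. V \<in> \<U> i \<Longrightarrow> x \<in> V \<Longrightarrow> y \<in> V \<Longrightarrow> dist x y \<le> r / 2^i"
    by metis
  define M where "M = (\<Union>n. stars \<U> 0 n {p})"
  define E where "E = closure M"
  have inS: "stars \<U> 0 n {p} \<subseteq> S" for n
    by (induction n) (use p open\<U> openin_imp_subset in \<open>fastforce simp: star_def\<close>)+
  have inF: "stars \<U> 0 n {p} \<subseteq> F" for n
  proof
    fix y assume y: "y \<in> stars \<U> 0 n {p}"
    then have "dist p y \<le> 2 * r" using stars_dist[of \<U> r y 0 n "{p}"] small r by auto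
    then show "y \<in> F" using e y inS r WF by force
  qed
  have "M \<subseteq> F" using inF by (auto simp: M_def)
  then have "E \<subseteq> F" unfolding E_def using WF(2) by (simp add: closure_minimal compact_imp_closed)
  have "p \<in> M" unfolding M_def using stars_superset by fastforce
  obtain V\<^sub>0 where V0: "V\<^sub>0 \<in> \<U> 0" "p \<in> V\<^sub>0" using cover WF by blast
  have "V\<^sub>0 \<subseteq> stars \<U> 0 1 {p}" using V0 by (auto simp: star_def)
  also have "\<dots> \<subseteq> M" unfolding M_def by (rule UN_upper) simp
  also have "\<dots> \<subseteq> E" unfolding E_def by (rule closure_subset)
  finally have "V\<^sub>0 \<subseteq> E" .
  have "connected M" unfolding M_def
    by (rule connected_UN_stars) (use conn\<U> in auto)
  have "locally connected E"
  proof (rule property_S_imp_locally_connected)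
    fix \<epsilon> :: real assume "\<epsilon> > 0"
    then have "\<epsilon> / (3 * r) > 0" using r by simp
    then obtain k where k: "(1/2::real) ^ k < \<epsilon> / (3 * r)"
      using real_arch_pow_inv[of "\<epsilon> / (3 * r)" "1/2"] by auto
    have k': "3 * (r / 2^k) \<le> \<epsilon>"
      using k r by (simp add: field_simps power_one_over)
    define \<V> where "\<V> = {V \<in> \<U> k. V \<inter> stars \<U> 0 k {p} \<noteq> {}}"
    define P where "P = (\<lambda>V. \<Union>n. stars \<U> (Suc k) n V)"
    have stage: "stars \<U> 0 (Suc k) {p} = \<Union>\<V>"
    proof
      show "stars \<U> 0 (Suc k) {p} \<subseteq> \<Union>\<V>"
      proof
        fix y assume y: "y \<in> stars \<U> 0 (Suc k) {p}"
        show "y \<in> \<Union>\<V>"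
        proof (cases "y \<in> stars \<U> 0 k {p}")
          case True
          then obtain V where "V \<in> \<U> k" "y \<in> V" using inF cover by blast
          then show ?thesis using True by (auto simp: \<V>_def)
        next
          case False
          then show ?thesis using y by (auto simp: star_def \<V>_def)
        qed
      qed
      show "\<Union>\<V> \<subseteq> stars \<U> 0 (Suc k) {p}" by (auto simp: star_def \<V>_def)
    qed
    have "M = (\<Union>n. stars \<U> 0 (Suc k + n) {p})"
    proof -
      have "stars \<U> 0 n {p} \<subseteq> stars \<U> 0 (Suc k + n) {p}" for n
        using stars_superset[of _ \<U> n "Suc k"] by (metis add.commute stars_add)
      then show ?thesis unfolding M_def by blast
    qed
    also have "\<dots> = (\<Union>V\<in>\<V>. P V)"
      unfolding stars_add stage stars_Union P_def by blast
    finally have "M = (\<Union>V\<in>\<V>. P V)" .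
    moreover have "finite \<V>" using fin by (simp add: \<V>_def)
    ultimately have E: "E = \<Union>((\<lambda>V. closure (P V)) ` \<V>)"
      unfolding E_def by (simp add: closure_finite_UN)
    have piece: "closed (closure (P V)) \<and> connected (closure (P V)) \<and>
        (\<forall>x\<in>closure (P V). \<forall>y\<in>closure (P V). dist x y \<le> \<epsilon>)" if V: "V \<in> \<V>" for V
    proof -
      have Vk: "V \<in> \<U> k" "V \<noteq> {}" using V by (auto simp: \<V>_def)
      have "connected (P V)" unfolding P_def
        by (rule connected_UN_stars) (use conn\<U> Vk in auto)
      \<comment> \<open>Twice the reach \<open>2 * r / 2 ^ (k + 1)\<close> of the tail, plus the size of \<open>V\<close>.\<close>
      have "dist x y \<le> 3 * (r / 2^k)" if xy: "x \<in> P V" "y \<in> P V" for x y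
      proof -
        have "\<exists>a\<in>V. dist a z \<le> r / 2^k" if "z \<in> P V" for z
          using that stars_dist[of \<U> r z "Suc k" _ V] small r(1) by (auto simp: P_def)
        then obtain a b where ab: "a \<in> V" "dist a x \<le> r / 2^k" "b \<in> V" "dist b y \<le> r / 2^k"
          using xy by meson
        have "dist a b \<le> r / 2^k" using small Vk ab by blast
        then show ?thesis
          using ab dist_triangle3[of x y a] dist_triangle[of a y b] by linarith
      qed
      then have bound: "\<And>x y. x \<in> P V \<Longrightarrow> y \<in> P V \<Longrightarrow> dist x y \<le> \<epsilon>"
        using k' by fastforce
      have "dist x y \<le> \<epsilon>" if "x \<in> closure (P V)" "y \<in> closure (P V)" for x y
      proof -
        have "P V \<subseteq> cball z \<epsilon>" if "z \<in> P V" for z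
          using bound that by auto
        then have "y \<in> cball z \<epsilon>" if "z \<in> P V" for z
          using that \<open>y \<in> closure (P V)\<close> closure_minimal[OF _ closed_cball] by blast
        then have "P V \<subseteq> cball y \<epsilon>" by (auto simp: dist_commute)
        then have "closure (P V) \<subseteq> cball y \<epsilon>" by (rule closure_minimal) simp
        then show ?thesis using that(1) by (auto simp: dist_commute)
      qed
      then show ?thesis using \<open>connected (P V)\<close> by (simp add: connected_imp_connected_closure)
    qed
    show "\<exists>\<P>. finite \<P> \<and> E = \<Union>\<P> \<and>
      (\<forall>P\<in>\<P>. closed P \<and> connected P \<and> (\<forall>x\<in>P. \<forall>y\<in>P. dist x y \<le> \<epsilon>))"
      by (rule exI[of _ "(\<lambda>V. closure (P V)) ` \<V>"]) (use E \<open>finite \<V>\<close> piece in auto)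
  qed
  moreover have "compact E"
    using \<open>E \<subseteq> F\<close> WF(2) compact_Int_closed[of F E] by (simp add: E_def inf.absorb2)
  moreover have "connected E" unfolding E_def using \<open>connected M\<close> by (rule connected_imp_connected_closure)
  ultimately show ?thesis
    using that[of V\<^sub>0 E] open\<U>[OF V0(1)] V0 \<open>V\<^sub>0 \<subseteq> E\<close> \<open>E \<subseteq> F\<close> WF(5) by blast
qed

section \<open>Components of the complement of a closed set\<close>

lemma openin_component_complement:
  assumes "locally connected S" "closedin (top_of_set S) A" "G \<in> components (S - A)"
  shows "openin (top_of_set S) G"
  using assms locally_connected_open_component openin_diff[OF openin_subtopology_self assms(2)]
  by blast

text \<open>A component of \<open>S - A\<close> is open in \<open>S\<close> by local connectedness, so if it did not
  reach \<open>A\<close> it would be clopen in the connected set \<open>S\<close>.\<close>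

lemma component_complement_reaches:
  assumes "connected S" "locally connected S" "closedin (top_of_set S) A" "A \<noteq> {}"
    and H: "H \<in> components (S - A)"
  obtains b where "b \<in> A" "b \<in> closure H"
proof -
  have AS: "A \<subseteq> S" using assms(3) closedin_imp_subset by blast
  have HS: "H \<subseteq> S - A" "H \<noteq> {}" using H in_components_subset in_components_nonempty by blast+
  have oH: "openin (top_of_set S) H"
    using openin_component_complement[OF assms(2,3) H] .
  have "A \<inter> closure H \<noteq> {}"
  proof
    assume disj: "A \<inter> closure H = {}"
    obtain C where "closed C" "H = (S - A) \<inter> C"
      using closedin_component[OF H] unfolding closedin_closed by blast
    then have "H = (S - A) \<inter> closure H"
      using closure_minimal[of H C] closure_subset[of H] by blast
    then have "H = S \<inter> closure H" using disj by blast
    then have "closedin (top_of_set S) H"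
      by (metis closed_closure closedin_closed_Int)
    then have "H = S" using assms(1) oH HS unfolding connected_clopen by blast
    then show False using HS AS assms(4) by blast
  qed
  then show ?thesis using that by blast
qed

lemma connected_Un_components:
  assumes "connected S" "locally connected S" "closedin (top_of_set S) E" "E \<noteq> {}" "connected E"
    and "\<G> \<subseteq> components (S - E)"
  shows "connected (E \<union> \<Union>\<G>)"
proof -
  have "connected (E \<union> G)" if "G \<in> \<G>" for G
  proof -
    have G: "G \<in> components (S - E)" using that assms by blast
    obtain b where b: "b \<in> E" "b \<in> closure G"
      by (rule component_complement_reaches[OF assms(1-4) G])
    have "connected (insert b G)"
      by (rule connected_intermediate_closure[OF in_components_connected[OF G]])
        (use b closure_subset in auto)
    then have "connected (E \<union> insert b G)" using b assms(5) by (intro connected_Un) auto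
    then show ?thesis using b by (simp add: insert_absorb)
  qed
  then have "connected (\<Union>(insert E ((\<lambda>G. E \<union> G) ` \<G>)))"
    using assms(4,5) by (intro connected_Union) auto
  moreover have "\<Union>(insert E ((\<lambda>G. E \<union> G) ` \<G>)) = E \<union> \<Union>\<G>" by blast
  ultimately show ?thesis by simp
qed

text \<open>Near a point of an added component nothing changes, as the components are open in \<open>S\<close>.
  For a point \<open>x\<close> of \<open>E\<close>, inside a small connected
  open neighbourhood of \<open>x\<close> in \<open>S\<close>, every added point lies in a connected set that reaches
  the part of \<open>E\<close> near \<open>x\<close> without leaving the neighbourhood, and it never leaves the added
  component.\<close>

lemma locally_connected_Un_components:
  assumes lS: "locally connected S" and cE: "closedin (top_of_set S) E"
    and lE: "locally connected E" and \<G>: "\<G> \<subseteq> components (S - E)"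
  shows "locally connected (E \<union> \<Union>\<G>)"
  unfolding locally_connected_im_kleinen
proof (intro allI impI)
  fix v x
  let ?E' = "E \<union> \<Union>\<G>"
  assume v: "openin (top_of_set ?E') v \<and> x \<in> v"
  then obtain W where W: "open W" "v = ?E' \<inter> W" unfolding openin_open by blast
  have ES: "E \<subseteq> S" using cE closedin_imp_subset by blast
  have oG: "openin (top_of_set S) G" if "G \<in> \<G>" for G
    using openin_component_complement[OF lS cE] \<G> that by blast
  then have E'S: "?E' \<subseteq> S" using ES openin_imp_subset by blast
  show "\<exists>u. openin (top_of_set ?E') u \<and> x \<in> u \<and> u \<subseteq> v \<and>
      (\<forall>y. y \<in> u \<longrightarrow> (\<exists>c. connected c \<and> c \<subseteq> v \<and> x \<in> c \<and> y \<in> c))"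
  proof (cases "x \<in> E")
    case False
    then obtain G where G: "G \<in> \<G>" "x \<in> G" using v W by blast
    then have "openin (top_of_set S) (G \<inter> W)" using oG W by (simp add: openin_Int_open)
    moreover have "x \<in> G \<inter> W" using G v W by blast
    ultimately obtain u where u: "openin (top_of_set S) u" "connected u" "x \<in> u" "u \<subseteq> G \<inter> W"
      using lS unfolding locally_connected by meson
    then have "openin (top_of_set ?E') u"
      using openin_subset_trans[OF u(1) _ E'S] G by blast
    then show ?thesis using u G W by blast
  next
    case True
    have "openin (top_of_set E) (E \<inter> W)" "x \<in> E \<inter> W" using True v W by (auto intro: openin_open_Int)
    then obtain V where V: "openin (top_of_set E) V" "connected V" "x \<in> V" "V \<subseteq> E \<inter> W"
      using lE unfolding locally_connected by meson
    then obtain T where T: "open T" "V = E \<inter> T" unfolding openin_open by blast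
    then have "openin (top_of_set S) (S \<inter> (W \<inter> T))"
      using W by (simp add: openin_open_Int open_Int)
    moreover have "x \<in> S \<inter> (W \<inter> T)"
      using T V ES by blast
    ultimately obtain Q where Q: "openin (top_of_set S) Q" "connected Q" "x \<in> Q" "Q \<subseteq> S \<inter> (W \<inter> T)"
      using lS unfolding locally_connected by meson
    have lQ: "locally connected Q" using locally_open_subset[OF lS Q(1)] .
    have QS: "Q \<subseteq> S" using Q by blast
    have cQ: "closedin (top_of_set Q) (Q \<inter> E)"
      using cE QS by (auto simp: closedin_closed)
    have ne: "Q \<inter> E \<noteq> {}" using Q True by blast
    have "openin (top_of_set ?E') (?E' \<inter> Q)"
      using Q(1) E'S by (auto simp: openin_open)
    moreover have "x \<in> ?E' \<inter> Q" "?E' \<inter> Q \<subseteq> v" using True Q W by auto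
    moreover have "\<exists>c. connected c \<and> c \<subseteq> v \<and> x \<in> c \<and> y \<in> c" if y: "y \<in> ?E' \<inter> Q" for y
    proof (cases "y \<in> E")
      case True
      then have "y \<in> V" using y Q T by blast
      then show ?thesis using V W by blast
    next
      case False
      then obtain G where G: "G \<in> \<G>" "y \<in> G" using y by blast
      have "y \<in> Q - Q \<inter> E" using y False by blast
      then obtain H where H: "H \<in> components (Q - Q \<inter> E)" "y \<in> H"
        using Union_components by blast
      obtain b where b: "b \<in> Q \<inter> E" "b \<in> closure H"
        by (rule component_complement_reaches[OF Q(2) lQ cQ ne H(1)])
      have HQ: "H \<subseteq> Q - E" using H in_components_subset by blast
      have "H \<subseteq> G"
        using components_maximal[of G "S - E" H] G H \<G> in_components_connected HQ QS by blast
      have "connected (insert b H)"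
        by (rule connected_intermediate_closure[OF in_components_connected[OF H(1)]])
          (use b closure_subset in auto)
      moreover have "b \<in> V" using b Q T by blast
      ultimately have "connected (V \<union> insert b H)"
        using V(2) by (intro connected_Un) auto
      moreover have "V \<union> insert b H \<subseteq> v"
        using V W \<open>H \<subseteq> G\<close> G HQ Q \<open>b \<in> V\<close> by blast
      ultimately show ?thesis using V H by blast
    qed
    ultimately show ?thesis by blast
  qed
qed

text \<open>A component that leaves \<open>F\<close> also reaches \<open>E\<close> and so enters \<open>U\<close>; being connected it meets
  the compact set \<open>F - U\<close>, which is covered by the disjoint open components.\<close>

lemma finite_components_escaping_compact:
  fixes S :: "'a::metric_space set"
  assumes "connected S" "locally connected S" "closedin (top_of_set S) E" "E \<noteq> {}"
    and U: "openin (top_of_set S) U" "E \<subseteq> U" "U \<subseteq> F" and F: "compact F" "F \<subseteq> S"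
  shows "finite {G \<in> components (S - E). \<not> G \<subseteq> F}"
proof -
  obtain T where T: "open T" "U = S \<inter> T" using U(1) unfolding openin_open by blast
  have "F - U = F - T" using T F by blast
  then have cFU: "compact (F - U)" using F T by (simp add: compact_diff)
  have oG: "openin (top_of_set S) G" if "G \<in> components (S - E)" for G
    using openin_component_complement[OF assms(2,3) that] .
  have "F - U \<subseteq> \<Union>(components (S - E))" using F U by auto
  then obtain \<D> where \<D>: "finite \<D>" "\<D> \<subseteq> components (S - E)" "F - U \<subseteq> \<Union>\<D>"
    by (rule compact_openin_subcover[OF cFU]) (use oG F in auto)
  have "G \<in> \<D>" if G: "G \<in> components (S - E)" "\<not> G \<subseteq> F" for G
  proof -
    have GS: "G \<subseteq> S" using in_components_subset[OF G(1)] by blast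
    obtain b where b: "b \<in> E" "b \<in> closure G"
      by (rule component_complement_reaches[OF assms(1-4) G(1)])
    then have "T \<inter> G \<noteq> {}"
      using T U open_Int_closure_eq_empty[OF T(1), of G] by blast
    moreover have "- F \<inter> G \<noteq> {}" using G by blast
    moreover have "open (- F)" using F compact_imp_closed by blast
    moreover have "T \<inter> - F \<inter> G = {}" using T U GS by blast
    ultimately have "\<not> G \<subseteq> T \<union> - F"
      using connectedD[OF in_components_connected[OF G(1)] T(1)] by blast
    then obtain z where z: "z \<in> G" "z \<in> F - U" using T by blast
    then obtain D where "D \<in> \<D>" "z \<in> D" using \<D> by blast
    then show ?thesis using components_eq[OF G(1), of D] \<D>(2) z by blast
  qed
  then show ?thesis using \<D>(1) by (auto intro: finite_subset)
qed

text \<open>Every component of the union contains a member of the family, and is the component of any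
  point of that member.\<close>

lemma finite_components_Union_connected:
  assumes "finite \<C>" "\<And>C. C \<in> \<C> \<Longrightarrow> connected C"
  shows "finite (components (\<Union>\<C>))"
proof -
  have "components (\<Union>\<C>) \<subseteq> (\<lambda>C. connected_component_set (\<Union>\<C>) (SOME c. c \<in> C)) ` \<C>"
  proof
    fix D assume D: "D \<in> components (\<Union>\<C>)"
    then obtain z where z: "z \<in> \<Union>\<C>" "D = connected_component_set (\<Union>\<C>) z"
      by (auto simp: components_iff)
    then obtain C where C: "C \<in> \<C>" "z \<in> C" by blast
    have "C \<subseteq> D" using z C assms(2) by (simp add: Union_upper connected_component_maximal)
    moreover have "(SOME c. c \<in> C) \<in> C" using C by (metis someI)
    ultimately have "D = connected_component_set (\<Union>\<C>) (SOME c. c \<in> C)"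
      using z connected_component_eq by blast
    then show "D \<in> (\<lambda>C. connected_component_set (\<Union>\<C>) (SOME c. c \<in> C)) ` \<C>" using C by blast
  qed
  then show ?thesis using assms(1) finite_surj by blast
qed

section \<open>Compact neighbourhoods in a closed graph\<close>

lemma graph_on_iff [simp]: "(a, b) \<in> graph_on f A \<longleftrightarrow> a \<in> A \<and> b = f a"
  by (auto simp: graph_on_def)

lemma isCont_interior_fst_compact_graph:
  fixes f :: "'a::metric_space \<Rightarrow> 'b::metric_space"
  assumes E: "compact E" "E \<subseteq> graph_on f UNIV" and y: "y \<in> interior (fst ` E)"
  shows "isCont f y"
proof -
  \<comment> \<open>The inverse of the projection is continuous on the compact image.\<close>
  have "continuous_on (fst ` E) (\<lambda>x. (x, f x))"
    using continuous_on_inv[of E fst "\<lambda>x. (x, f x)"] E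
    by (force simp: graph_on_def intro: continuous_intros)
  then have "continuous_on (fst ` E) f"
    using continuous_on_snd[of "fst ` E" "\<lambda>x. (x, f x)"] by simp
  then show ?thesis using y continuous_on_interior by blast
qed

text \<open>If \<open>f\<close> is continuous at \<open>y\<close>, the graph over a neighbourhood of \<open>y\<close> stays in \<open>U\<close>, so that
  \<open>y\<close> is interior to the projection of \<open>E\<close>.\<close>

lemma discontinuities_eq_frontier_in_open:
  fixes f :: "'a::metric_space \<Rightarrow> 'b::metric_space"
  assumes E: "compact E" "E \<subseteq> graph_on f UNIV"
    and U: "openin (top_of_set (graph_on f UNIV)) U" "U \<subseteq> E" and y: "(y, f y) \<in> U"
  shows "y \<in> discontinuities f \<longleftrightarrow> y \<in> frontier (fst ` E)"
proof -
  have "closed (fst ` E)"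
    using E by (simp add: compact_continuous_image continuous_on_fst compact_imp_closed)
  moreover have "y \<in> fst ` E" using U y by force
  ultimately have fr: "y \<in> frontier (fst ` E) \<longleftrightarrow> y \<notin> interior (fst ` E)"
    by (simp add: frontier_def)
  have "y \<in> interior (fst ` E)" if c: "isCont f y"
  proof -
    obtain T where T: "open T" "U = graph_on f UNIV \<inter> T" using U(1) unfolding openin_open by blast
    have "isCont (\<lambda>x. (x, f x)) y" using c by (intro continuous_intros)
    then obtain N where N: "open N" "y \<in> N" "\<And>z. z \<in> N \<Longrightarrow> (z, f z) \<in> T"
      using T y unfolding continuous_at_open by (metis Int_iff)
    then have "N \<subseteq> fst ` E" using T U by force
    then show ?thesis using N interior_maximal by blast
  qed
  then show ?thesis
    using fr isCont_interior_fst_compact_graph[OF E] by (auto simp: discontinuities_def)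
qed

text \<open>A cluster value \<open>l\<close> of \<open>f\<close> along the net gives a cluster point \<open>(x, l)\<close> of the graph,
  so \<open>l = f x\<close>; but then the net of graph points would enter \<open>U\<close>.\<close>

lemma nets_to_empty_outside_neighbourhood:
  fixes f :: "'a::metric_space \<Rightarrow> 'b::metric_space"
  assumes cl: "closed (graph_on f UNIV)"
    and U: "openin (top_of_set (graph_on f UNIV)) U" "U \<subseteq> E" and x: "(x, f x) \<in> U"
  shows "nets_to_empty f (- fst ` E) x"
  unfolding nets_to_empty_def
proof (intro allI impI, elim conjE)
  fix I :: "('a set \<times> 'a) set" and le s
  assume d: "directed_set I le" and s: "s ` I \<subseteq> - fst ` E" and cv: "net_converges I le s x"
  show "net_to_empty I le (f \<circ> s)"
  proof (rule ccontr)
    assume "\<not> ?thesis"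
    then obtain l where l: "\<And>V i. open V \<Longrightarrow> l \<in> V \<Longrightarrow> i \<in> I \<Longrightarrow> \<exists>j\<in>I. le i j \<and> f (s j) \<in> V"
      unfolding net_to_empty_def using convergent_subnet_imp_cluster[OF d] by fastforce
    have cluster: "\<exists>j\<in>I. (s j, f (s j)) \<in> T" if T: "open T" "(x, l) \<in> T" for T
    proof -
      obtain A B where AB: "open A" "open B" "(x, l) \<in> A \<times> B" "A \<times> B \<subseteq> T"
        using T open_prod_elim by metis
      then obtain i where i: "i \<in> I" "\<And>j. j \<in> I \<Longrightarrow> le i j \<Longrightarrow> s j \<in> A"
        using cv[unfolded net_converges_def, rule_format, of A] AB(1,3) by auto
      obtain j where "j \<in> I" "le i j" "f (s j) \<in> B" using l[OF AB(2) _ i(1)] AB(3) by auto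
      then show ?thesis using i(2) AB(4) by blast
    qed
    have "l = f x"
    proof (rule ccontr)
      assume "l \<noteq> f x"
      then have "(x, l) \<in> - graph_on f UNIV" by simp
      then show False using cluster[of "- graph_on f UNIV"] cl by auto
    qed
    obtain T where T: "open T" "U = graph_on f UNIV \<inter> T" using U(1) unfolding openin_open by blast
    then obtain j where "j \<in> I" "(s j, f (s j)) \<in> T"
      using cluster[OF T(1)] x \<open>l = f x\<close> by blast
    then have "(s j, f (s j)) \<in> E" using T U by auto
    then show False using s \<open>j \<in> I\<close> by force
  qed
qed

section \<open>Finitely many complementary components\<close>

text \<open>A component of the complement of the projection of \<open>E\<^sub>0\<close> over which the graph leaves \<open>F\<close>
  contains the projection of a component of \<open>\<Gamma> - E\<^sub>0\<close> that leaves \<open>F\<close>, so there are finitely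
  many of them. All the others are filled in; the complement of the result is then the union of
  the finitely many exceptional ones.\<close>

lemma fill_complementary_components:
  fixes f :: "'a::metric_space \<Rightarrow> 'b::metric_space"
  assumes lX: "locally connected (UNIV :: 'a set)"
    and lc: "locally compact (graph_on f UNIV)"
    and conn: "connected (graph_on f UNIV)" and lconn: "locally connected (graph_on f UNIV)"
    and E0: "compact E\<^sub>0" "connected E\<^sub>0" "locally connected E\<^sub>0" "E\<^sub>0 \<subseteq> graph_on f UNIV" "E\<^sub>0 \<noteq> {}"
  obtains E where "E\<^sub>0 \<subseteq> E" "E \<subseteq> graph_on f UNIV" "compact E" "connected E" "locally connected E"
    "finite (components (- fst ` E))"
proof -
  let ?\<Gamma> = "graph_on f UNIV"
  define K where "K = fst ` E\<^sub>0"
  have "closed K"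
    using E0 by (simp add: K_def compact_continuous_image continuous_on_fst compact_imp_closed)
  have cE: "closedin (top_of_set ?\<Gamma>) E\<^sub>0"
    using E0 compact_imp_closed by (auto simp: closedin_closed)
  have offE: "z \<in> ?\<Gamma> - E\<^sub>0 \<longleftrightarrow> z \<in> ?\<Gamma> \<and> fst z \<notin> K" for z
    using E0(4) by (auto simp: K_def graph_on_def)
  obtain U F where UF: "openin (top_of_set ?\<Gamma>) U" "compact F" "E\<^sub>0 \<subseteq> U" "U \<subseteq> F" "F \<subseteq> ?\<Gamma>"
    by (rule compact_neighbourhood_of_compact[OF lc E0(1,4)])
  define \<G> where "\<G> = {G \<in> components (?\<Gamma> - E\<^sub>0). \<not> G \<subseteq> F}"
  have fin\<G>: "finite \<G>"
    unfolding \<G>_def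
    by (rule finite_components_escaping_compact[OF conn lconn cE E0(5) UF(1,3,4,2,5)])
  define \<B> where "\<B> = {C \<in> components (- K). \<not> graph_on f C \<subseteq> F}"
  have project: "fst ` G \<subseteq> C"
    if "G \<in> components (?\<Gamma> - E\<^sub>0)" "C \<in> components (- K)" "z \<in> G" "fst z \<in> C" for G C z
  proof (rule components_maximal[OF that(2)])
    show "connected (fst ` G)"
      by (intro connected_continuous_image in_components_connected[OF that(1)] continuous_intros)
    have "G \<subseteq> ?\<Gamma> - E\<^sub>0" using that(1) by (rule in_components_subset)
    then show "fst ` G \<subseteq> - K" using offE by blast
    show "C \<inter> fst ` G \<noteq> {}" using that(3,4) by blast
  qed
  have "\<exists>G\<in>\<G>. fst ` G \<subseteq> C" if C: "C \<in> \<B>" for C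
  proof -
    obtain y where y: "y \<in> C" "(y, f y) \<notin> F" and C': "C \<in> components (- K)"
      using C by (auto simp: \<B>_def graph_on_def)
    have "y \<notin> K" using y C' in_components_subset by blast
    then have "(y, f y) \<in> \<Union>(components (?\<Gamma> - E\<^sub>0))"
      unfolding Union_components offE by simp
    then obtain G where G: "G \<in> components (?\<Gamma> - E\<^sub>0)" "(y, f y) \<in> G" by blast
    then have "fst ` G \<subseteq> C" using project C' y by force
    then show ?thesis using G y by (auto simp: \<G>_def)
  qed
  then obtain g where g: "\<And>C. C \<in> \<B> \<Longrightarrow> g C \<in> \<G> \<and> fst ` g C \<subseteq> C" by metis
  have "inj_on g \<B>"
  proof (rule inj_onI)
    fix C D assume CD: "C \<in> \<B>" "D \<in> \<B>" "g C = g D"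
    have "g C \<noteq> {}" using g[OF CD(1)] in_components_nonempty by (auto simp: \<G>_def)
    then have "C \<inter> D \<noteq> {}" using g[OF CD(1)] g[OF CD(2)] CD(3) by blast
    moreover have "C \<in> components (- K)" "D \<in> components (- K)"
      using CD by (auto simp: \<B>_def)
    ultimately show "C = D" using components_eq by blast
  qed
  then have fin\<B>: "finite \<B>"
    using fin\<G> g by (meson finite_imageD finite_subset image_subsetI)
  have "open C" if "C \<in> components (- K)" for C
    using openin_component_complement[OF lX, of K C] that \<open>closed K\<close>
    by (simp add: Compl_eq_Diff_UNIV)
  then have op: "open (\<Union>\<B>)" by (auto simp: \<B>_def)
  define E where "E = graph_on f (- \<Union>\<B>)"
  have K\<B>: "K \<inter> \<Union>\<B> = {}" using in_components_subset by (fastforce simp: \<B>_def)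
  have "E \<subseteq> F"
  proof
    fix z assume z: "z \<in> E"
    then obtain y where y: "z = (y, f y)" "y \<notin> \<Union>\<B>" by (auto simp: E_def graph_on_def)
    show "z \<in> F"
    proof (cases "y \<in> K")
      case True
      then have "z \<in> E\<^sub>0" using E0(4) y by (auto simp: K_def graph_on_def)
      then show ?thesis using UF by blast
    next
      case False
      then obtain C where C: "C \<in> components (- K)" "y \<in> C"
        using Union_components[of "- K"] by blast
      then have "graph_on f C \<subseteq> F" using y by (auto simp: \<B>_def)
      then show ?thesis using C y by auto
    qed
  qed
  then have "E = F \<inter> fst -` (- \<Union>\<B>)"
    using UF(5) by (force simp: E_def graph_on_def)
  moreover have "closed (fst -` (- \<Union>\<B>) :: ('a \<times> 'b) set)"
    using op by (intro closed_vimage continuous_intros) auto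
  ultimately have "compact E" using UF(2) by (simp add: compact_Int_closed)
  \<comment> \<open>A component of \<open>\<Gamma> - E\<^sub>0\<close> lies over a single component of the complement of \<open>K\<close>, so what was
     added to \<open>E\<^sub>0\<close> is a union of such components.\<close>
  define \<G>' where "\<G>' = {G \<in> components (?\<Gamma> - E\<^sub>0). G \<subseteq> E}"
  have "E \<subseteq> E\<^sub>0 \<union> \<Union>\<G>'"
  proof
    fix z assume z: "z \<in> E"
    show "z \<in> E\<^sub>0 \<union> \<Union>\<G>'"
    proof (cases "z \<in> E\<^sub>0")
      case False
      have z\<Gamma>: "z \<in> ?\<Gamma>" using z by (auto simp: E_def graph_on_def)
      then have nK: "fst z \<notin> K" using offE False by blast
      then obtain C where C: "C \<in> components (- K)" "fst z \<in> C"
        using Union_components[of "- K"] by blast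
      have "C \<notin> \<B>" using C z by (auto simp: E_def graph_on_def)
      have "C \<inter> B = {}" if "B \<in> \<B>" for B
      proof -
        have "B \<in> components (- K)" using that by (simp add: \<B>_def)
        then show ?thesis using components_eq[OF C(1)] that \<open>C \<notin> \<B>\<close> by blast
      qed
      then have off: "C \<inter> \<Union>\<B> = {}" by blast
      obtain G where G: "G \<in> components (?\<Gamma> - E\<^sub>0)" "z \<in> G"
        using z\<Gamma> False Union_components[of "?\<Gamma> - E\<^sub>0"] by blast
      have GC: "fst ` G \<subseteq> C" by (rule project[OF G(1) C(1) G(2) C(2)])
      have "G \<subseteq> E"
      proof
        fix w assume w: "w \<in> G"
        then have "w \<in> ?\<Gamma>" using in_components_subset[OF G(1)] by blast
        moreover have "fst w \<notin> \<Union>\<B>" using w GC off by blast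
        ultimately show "w \<in> E" by (auto simp: E_def graph_on_def)
      qed
      then show ?thesis using G by (auto simp: \<G>'_def)
    qed auto
  qed
  moreover have "E\<^sub>0 \<subseteq> E" using E0(4) K\<B> by (force simp: E_def K_def graph_on_def)
  ultimately have E: "E = E\<^sub>0 \<union> \<Union>\<G>'" by (auto simp: \<G>'_def)
  have sub: "\<G>' \<subseteq> components (?\<Gamma> - E\<^sub>0)" by (auto simp: \<G>'_def)
  show ?thesis
  proof
    show "E\<^sub>0 \<subseteq> E" by fact
    show "E \<subseteq> ?\<Gamma>" by (auto simp: E_def graph_on_def)
    show "compact E" by fact
    show "connected E"
      unfolding E by (rule connected_Un_components[OF conn lconn cE E0(5,2) sub])
    show "locally connected E"
      unfolding E by (rule locally_connected_Un_components[OF lconn cE E0(3) sub])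
    have "- fst ` E = \<Union>\<B>" by (force simp: E_def graph_on_def)
    moreover have "finite (components (\<Union>\<B>))"
      using fin\<B> in_components_connected
      by (intro finite_components_Union_connected) (auto simp: \<B>_def)
    ultimately show "finite (components (- fst ` E))" by simp
  qed
qed

theorem theorem13:
  fixes f :: "'a::{metric_space, second_countable_topology} \<Rightarrow>
              'b::{metric_space, second_countable_topology}"
  assumes "connected (UNIV :: 'a set)" and "locally connected (UNIV :: 'a set)"
    and "locally compact (UNIV :: 'a set)"
    and "locally compact (UNIV :: 'b set)"
    and "closed (graph_on f UNIV)"
    and "connected (graph_on f UNIV)"
    and "locally connected (graph_on f UNIV)"
  shows "\<forall>x \<in> discontinuities f. \<exists>U E.
    openin (top_of_set (graph_on f UNIV)) U \<and>
    compact E \<and> connected E \<and> locally connected E \<and>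
    (x, f x) \<in> U \<and> U \<subseteq> E \<and> E \<subseteq> graph_on f UNIV \<and>
    U \<inter> graph_on f (discontinuities f) = U \<inter> graph_on f (frontier (fst ` E)) \<and>
    x \<in> frontier (fst ` E) \<and>
    nets_to_empty f (- fst ` E) x \<and>
    finite (components (- fst ` E))"
proof
  fix x assume x: "x \<in> discontinuities f"
  let ?\<Gamma> = "graph_on f UNIV"
  have "locally compact (UNIV \<times> UNIV :: ('a \<times> 'b) set)"
    by (rule locally_Times[OF assms(3,4)]) (simp add: compact_Times)
  then have lc: "locally compact ?\<Gamma>"
    by (rule locally_compact_closedin_subset) (simp add: assms(5))
  obtain U E\<^sub>0 where U: "openin (top_of_set ?\<Gamma>) U" "(x, f x) \<in> U" "U \<subseteq> E\<^sub>0"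
    and E0: "E\<^sub>0 \<subseteq> ?\<Gamma>" "compact E\<^sub>0" "connected E\<^sub>0" "locally connected E\<^sub>0"
    by (rule locally_connected_continuum_neighbourhood[OF lc assms(7), of "(x, f x)"]) auto
  have "E\<^sub>0 \<noteq> {}" using U by blast
  obtain E where E: "E\<^sub>0 \<subseteq> E" "E \<subseteq> ?\<Gamma>" "compact E" "connected E" "locally connected E"
    "finite (components (- fst ` E))"
    by (rule fill_complementary_components[OF assms(2) lc assms(6,7) E0(2-4,1) \<open>E\<^sub>0 \<noteq> {}\<close>])
  have UE: "U \<subseteq> E" using U E by blast
  note frontier = discontinuities_eq_frontier_in_open[OF E(3,2) U(1) UE]
  have "U \<inter> graph_on f (discontinuities f) = U \<inter> graph_on f (frontier (fst ` E))"
    using frontier by (auto simp: graph_on_def)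
  moreover have "x \<in> frontier (fst ` E)" using frontier[OF U(2)] x by blast
  moreover have "nets_to_empty f (- fst ` E) x"
    by (rule nets_to_empty_outside_neighbourhood[OF assms(5) U(1) UE U(2)])
  ultimately show "\<exists>U E. openin (top_of_set ?\<Gamma>) U \<and>
    compact E \<and> connected E \<and> locally connected E \<and>
    (x, f x) \<in> U \<and> U \<subseteq> E \<and> E \<subseteq> ?\<Gamma> \<and>
    U \<inter> graph_on f (discontinuities f) = U \<inter> graph_on f (frontier (fst ` E)) \<and>
    x \<in> frontier (fst ` E) \<and>
    nets_to_empty f (- fst ` E) x \<and>
    finite (components (- fst ` E))"
    using U(1,2) UE E by blast
qed

end
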